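(* For $q\in(0,1)$ let $\mathcal{E}_q$ denote the analytic continuation of the convergent series $\sum_{n\ge0}(-1)^n[n]_q^!x^{n+1}$, and let $\mathcal{E}$ denote the analytic continuation to $\mathbb{C}\smallsetminus(-\infty,0]$ of the function $$\mathcal{E}(x)=\int_0^{+\infty}\frac{e^{-t/x}}{t+1}\,dt,\qquad \Re x>0 .$$ If $q\to1^-$, then $\mathcal{E}_q(x)$ converges to $\mathcal{E}(x)$ for any $x\in\mathbb{C}\smallsetminus(-\infty,0]$, and the convergence is uniform on the compacts of $\mathbb{C}\smallsetminus(-\infty,0]$.
   Context: $[n]_q=\frac{q^n-1}{q-1}$, $[n]_q^!=[n]_q[n-1]_q\cdots[1]_q$, $[0]_q^!=1$. The series defining $\mathcal{E}_q$ converges for $|x|<1-q$ and continues analytically to $\mathbb{C}\smallsetminus\{(q-1)q^n:n\in\mathbb{Z},\,n\le0\}$. *)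

theory Defs
  imports "HOL-Complex_Analysis.Complex_Analysis"
begin

definition q_number :: "real \<Rightarrow> nat \<Rightarrow> real" where
  "q_number q n = (q ^ n - 1) / (q - 1)"

definition q_factorial :: "real \<Rightarrow> nat \<Rightarrow> real" where
  "q_factorial q n = (\<Prod>k=1..n. q_number q k)"

text \<open>
  A holomorphic function on \<open>D\<close> that agrees with \<open>f\<close> on \<open>U\<close>. In both uses below, \<open>D\<close> is open
  and connected and \<open>U\<close> is a nonempty open subset of \<open>D\<close>, so by the identity theorem the choice
  is determined on \<open>D\<close>; values outside \<open>D\<close> are irrelevant.
\<close>
definition analytic_continuation_to ::
    "(complex \<Rightarrow> complex) \<Rightarrow> complex set \<Rightarrow> complex set \<Rightarrow> complex \<Rightarrow> complex" where
  "analytic_continuation_to f U D = (SOME g. g holomorphic_on D \<and> (\<forall>x\<in>U. g x = f x))"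

definition q_euler_series :: "real \<Rightarrow> complex \<Rightarrow> complex" where
  "q_euler_series q x = (\<Sum>n. (-1) ^ n * complex_of_real (q_factorial q n) * x ^ (n + 1))"

definition q_euler_poles :: "real \<Rightarrow> complex set" where
  "q_euler_poles q = {complex_of_real ((q - 1) * q powi n) | n :: int. n \<le> 0}"

definition q_euler :: "real \<Rightarrow> complex \<Rightarrow> complex" where
  "q_euler q = analytic_continuation_to (q_euler_series q) (ball 0 (1 - q)) (- q_euler_poles q)"

definition euler_integral :: "complex \<Rightarrow> complex" where
  "euler_integral x =
     (LBINT t:{0..}. exp (- complex_of_real t / x) / (complex_of_real t + 1))"

text \<open>\<open>\<real>\<^sub>\<le>\<^sub>0\<close> is the library's set of nonpositive reals, here as a subset of the complex plane.\<close>
definition euler_fun :: "complex \<Rightarrow> complex" where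
  "euler_fun = analytic_continuation_to euler_integral {x. Re x > 0} (- \<real>\<^sub>\<le>\<^sub>0)"

end

theory Submission
  imports Defs
begin

text \<open>
  Put \<open>s\<^sub>k = q\<^sup>k / (1 - q)\<close>. The weights \<open>w\<^sub>k\<close> proportional to
  \<open>q\<^sup>k / ((1 - q) \<cdots> (1 - q\<^sup>k))\<close> form a probability distribution whose moments
  \<open>\<Sum>\<^sub>k w\<^sub>k s\<^sub>k\<^sup>n\<close> are the q-factorials, so the continued q-Euler series is the Stieltjes transform
  \<open>\<Sum>\<^sub>k w\<^sub>k x / (1 + x s\<^sub>k)\<close>. As the total mass is \<open>1\<close>, these functions are bounded on compact
  subsets of the slit plane uniformly in \<open>q\<close>, hence form a normal family. On the positive axis the
  linear q-difference equation of the series, compared with the differential equation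
  \<open>x\<^sup>2 y' + y = x\<close> of the Euler integral, gives pointwise convergence; Montel's theorem and the
  identity theorem extend it to locally uniform convergence on the slit plane.
\<close>

section \<open>The discrete measure with the q-factorials as moments\<close>

definition q_pochhammer :: "real \<Rightarrow> nat \<Rightarrow> real" where
  "q_pochhammer q n = (\<Prod>j=1..n. 1 - q ^ j)"

definition q_mass :: "real \<Rightarrow> nat \<Rightarrow> real" where
  "q_mass q k = q ^ k / q_pochhammer q k"

text \<open>With \<open>q_pochhammer q n\<close> the symbol (q;q)_n, Euler's identity evaluates the
  normalising sum as 1/(q;q)_infinity. Dividing by the sum itself avoids infinite products: only its
  convergence and positivity matter.\<close>

definition q_weight :: "real \<Rightarrow> nat \<Rightarrow> real" where
  "q_weight q k = q_mass q k / (\<Sum>j. q_mass q j)"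

definition q_node :: "real \<Rightarrow> nat \<Rightarrow> real" where
  "q_node q k = q ^ k / (1 - q)"

definition q_stieltjes :: "real \<Rightarrow> complex \<Rightarrow> complex" where
  "q_stieltjes q x =
     (\<Sum>k. complex_of_real (q_weight q k) * (x / (1 + x * complex_of_real (q_node q k))))"

lemma q_pochhammer_0 [simp]: "q_pochhammer q 0 = 1"
  by (simp add: q_pochhammer_def)

lemma q_pochhammer_Suc: "q_pochhammer q (Suc n) = (1 - q ^ Suc n) * q_pochhammer q n"
  by (simp add: q_pochhammer_def mult.commute)

lemma q_factorial_eq: "q_factorial q n = q_pochhammer q n / (1 - q) ^ n"
proof -
  have "q_number q k = (1 - q ^ k) / (1 - q)" for k
    unfolding q_number_def by (metis minus_diff_eq minus_divide_divide)
  then show ?thesis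
    by (simp add: q_factorial_def q_pochhammer_def prod_dividef)
qed

context
  fixes q :: real
  assumes q: "0 < q" "q < 1"
begin

lemma q_power_Suc_less_1: "q ^ Suc n < 1"
  using q by (metis power_Suc_less_one)

lemma q_pochhammer_pos: "q_pochhammer q n > 0"
  by (induction n) (use q_power_Suc_less_1 in \<open>auto simp: q_pochhammer_Suc simp del: power_Suc\<close>)

lemma q_mass_pos: "q_mass q k > 0"
  using q by (simp add: q_mass_def q_pochhammer_pos)

lemma q_mass_Suc: "(1 - q ^ Suc k) * q_mass q (Suc k) = q * q_mass q k"
  using q_pochhammer_pos[of k] q_power_Suc_less_1[of k]
  by (simp add: q_mass_def q_pochhammer_Suc field_simps)

lemma summable_q_mass: "summable (q_mass q)"
proof -
  have "(\<lambda>k. q ^ k) \<longlonglongrightarrow> 0"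
    using q by (intro LIMSEQ_power_zero) auto
  then have "\<forall>\<^sub>F k in sequentially. q ^ k < (1 - q) / 2"
    using q by (intro order_tendstoD) auto
  then obtain N where N: "\<And>k. k \<ge> N \<Longrightarrow> q ^ k < (1 - q) / 2"
    by (auto simp: eventually_sequentially)
  show ?thesis
  proof (rule summable_ratio_test)
    \<comment> \<open>The ratio of consecutive masses is q / (1 - q^(k+1)). Once q^(k+1) < (1 - q)/2
      the denominator exceeds (1 + q)/2, which gives this constant.\<close>
    show "2 * q / (1 + q) < 1" using q by simp
    fix k assume "N \<le> k"
    then have "q ^ Suc k < (1 - q) / 2" using N[of "Suc k"] by simp
    then have "(1 + q) / 2 * q_mass q (Suc k) \<le> (1 - q ^ Suc k) * q_mass q (Suc k)"
      using q_mass_pos[of "Suc k"] by (intro mult_right_mono) (auto simp: field_simps)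
    then have "(1 + q) / 2 * q_mass q (Suc k) \<le> q * q_mass q k" by (simp only: q_mass_Suc)
    then show "norm (q_mass q (Suc k)) \<le> 2 * q / (1 + q) * norm (q_mass q k)"
      using q q_mass_pos[of "Suc k"] q_mass_pos[of k] by (simp add: field_simps)
  qed
qed

lemma suminf_q_mass_pos: "(\<Sum>k. q_mass q k) > 0"
  by (intro suminf_pos summable_q_mass q_mass_pos)

lemma q_weight_pos: "q_weight q k > 0"
  by (simp add: q_weight_def q_mass_pos suminf_q_mass_pos)

text \<open>This recurrence is the source of both the moment formula and the q-difference equation
  of the Stieltjes transform.\<close>

lemma q_weight_Suc: "(1 - q ^ Suc k) * q_weight q (Suc k) = q * q_weight q k"
  using q_mass_Suc[of k] by (simp add: q_weight_def del: power_Suc)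

lemma q_weight_sums_1: "q_weight q sums 1"
  using sums_divide[OF summable_sums[OF summable_q_mass], of "\<Sum>k. q_mass q k"] suminf_q_mass_pos
  by (simp add: q_weight_def[abs_def])

text \<open>The recurrence for the weights turns multiplication by \<open>1 - q\<^sup>k\<close> into an index shift.\<close>

lemma q_weight_moment: "(\<lambda>k. q_weight q k * (q ^ k) ^ n) sums q_pochhammer q n"
proof (induction n)
  case 0
  then show ?case using q_weight_sums_1 by simp
next
  case (Suc n)
  \<comment> \<open>The factor \<open>1 - q ^ k\<close> kills the term k = 0, so the shifted series
    is the full one. Subtracting it from the n-th moment leaves the next moment.\<close>
  have "(\<lambda>k. (1 - q ^ k) * q_weight q k * (q ^ k) ^ n) sums (q ^ Suc n * q_pochhammer q n)"
  proof (rule sums_Suc_imp)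
    have "(1 - q ^ Suc k) * q_weight q (Suc k) * (q ^ Suc k) ^ n
            = q ^ Suc n * (q_weight q k * (q ^ k) ^ n)" for k
      unfolding q_weight_Suc by (simp add: power_mult_distrib)
    then show "(\<lambda>k. (1 - q ^ Suc k) * q_weight q (Suc k) * (q ^ Suc k) ^ n)
                 sums (q ^ Suc n * q_pochhammer q n)"
      using sums_mult[OF Suc, of "q ^ Suc n"] by simp
  qed simp
  from sums_diff[OF Suc this] show ?case
    by (simp add: q_pochhammer_Suc algebra_simps)
qed

section \<open>Nodes and the pole set\<close>

lemma q_node_pos: "q_node q k > 0"
  using q by (simp add: q_node_def)

lemma q_node_le: "q_node q k \<le> 1 / (1 - q)"
  using q by (simp add: q_node_def divide_right_mono power_le_one)

lemma q_node_Suc: "q_node q (Suc k) = q * q_node q k"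
  by (simp add: q_node_def)

lemma q_weight_node_moment: "(\<lambda>k. q_weight q k * q_node q k ^ n) sums q_factorial q n"
  using sums_divide[OF q_weight_moment, of n "(1 - q) ^ n"]
  by (simp add: q_node_def q_factorial_eq power_divide)

text \<open>For exponent -k the excluded point is the zero of \<open>1 + x * q_node q k\<close>, so
  the excluded set consists exactly of the poles of the terms of the Stieltjes series.\<close>

lemma q_euler_poles_eq: "q_euler_poles q = range (\<lambda>k. complex_of_real (- 1 / q_node q k))"
proof -
  have *: "(q - 1) * q powi (- int k) = - 1 / q_node q k" for k
    using q by (simp add: q_node_def power_int_minus field_simps)
  have "{n :: int. n \<le> 0} = range (\<lambda>k. - int k)"
    by (auto simp: image_iff) (metis int_nat_eq minus_minus neg_0_le_iff_le)
  then have "q_euler_poles q = (\<lambda>n. complex_of_real ((q - 1) * q powi n)) ` range (\<lambda>k. - int k)"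
    unfolding q_euler_poles_def by (auto simp: image_iff)
  then show ?thesis unfolding image_image * .
qed

text \<open>The poles -1/s_k recede from 0 with gaps of at least (1 - q)^2, and a uniformly discrete
  set is closed.\<close>

lemma closed_q_euler_poles: "closed (q_euler_poles q)"
proof -
  have gap: "1 / q_node q j \<ge> 1 / q_node q k + (1 - q) * (1 - q)" if "k < j" for j k
  proof -
    have "1 / q_node q j \<ge> 1 / q_node q (Suc k)"
      using that q by (auto simp: q_node_def intro!: divide_left_mono power_decreasing simp del: power_Suc)
    also have "1 / q_node q (Suc k) = 1 / q_node q k + (1 / q - 1) * (1 / q_node q k)"
      using q q_node_pos[of k] by (simp add: q_node_Suc field_simps)
    finally have "1 / q_node q j \<ge> 1 / q_node q k + (1 / q - 1) * (1 / q_node q k)" .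
    moreover have "(1 - q) * (1 - q) \<le> (1 / q - 1) * (1 / q_node q k)"
    proof (rule mult_mono)
      show "1 - q \<le> 1 / q_node q k"
        using q q_node_le[of k] q_node_pos[of k] by (simp add: field_simps)
      have "1 - q \<le> (1 - q) / q" using q by (simp add: pos_le_divide_eq mult_left_le)
      also have "\<dots> = 1 / q - 1" using q by (simp add: field_simps)
      finally show "1 - q \<le> 1 / q - 1" .
    qed (use q in auto)
    ultimately show ?thesis by linarith
  qed
  have sep: "dist (complex_of_real (- 1 / q_node q j)) (complex_of_real (- 1 / q_node q k))
               \<ge> (1 - q) * (1 - q)" if "j \<noteq> k" for j k
  proof -
    have "\<bar>- 1 / q_node q j - (- 1 / q_node q k)\<bar> \<ge> (1 - q) * (1 - q)"
      using gap[of j k] gap[of k j] that by (simp only: divide_minus_left) linarith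
    then show ?thesis unfolding dist_of_real dist_real_def .
  qed
  have "\<forall>x\<in>q_euler_poles q. \<forall>y\<in>q_euler_poles q. dist y x < (1 - q) * (1 - q) \<longrightarrow> y = x"
    unfolding q_euler_poles_eq by (metis (no_types, lifting) imageE sep linorder_not_less)
  then show ?thesis
    using q by (intro discrete_imp_closed[of "(1 - q) * (1 - q)"]) auto
qed

lemma connected_q_euler_domain: "connected (- q_euler_poles q)"
proof -
  have "countable (q_euler_poles q)" unfolding q_euler_poles_eq by simp
  then show ?thesis
    using connected_open_diff_countable[of "UNIV :: complex set" "q_euler_poles q"]
    by (simp add: Compl_eq_Diff_UNIV connected_UNIV)
qed

section \<open>Convergence and holomorphy of the Stieltjes series\<close>

lemma q_stieltjes_denominator:
  assumes K: "compact K" "K \<subseteq> - q_euler_poles q"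
  obtains d where "d > 0" "\<And>x k. x \<in> K \<Longrightarrow> norm (1 + x * complex_of_real (q_node q k)) \<ge> d"
proof -
  obtain e where e: "e > 0" "\<And>x p. x \<in> K \<Longrightarrow> p \<in> q_euler_poles q \<Longrightarrow> e \<le> dist x p"
    using separate_compact_closed[OF K(1) closed_q_euler_poles] K(2) by blast
  obtain M where M: "M > 0" "\<And>x. x \<in> K \<Longrightarrow> norm x \<le> M"
    using compact_imp_bounded[OF K(1)] bounded_pos by metis
  show ?thesis
  proof (rule that)
    \<comment> \<open>Two regimes of s = \<open>q_node q k\<close>. If s M <= 1/2, then |x s| <= 1/2
      and the denominator is at least 1/2. Otherwise write it as s (x + 1/s), where s > 1/(2M) and x
      has distance at least e from the pole -1/s.\<close>
    show "min (1/2) (e / (2 * M)) > 0" using e M by simp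
    fix x k assume x: "x \<in> K"
    define s where "s = q_node q k"
    have s: "s > 0" using q_node_pos s_def by simp
    show "norm (1 + x * complex_of_real (q_node q k)) \<ge> min (1/2) (e / (2 * M))"
    proof (cases "s * M \<le> 1/2")
      case True
      have "norm (x * complex_of_real s) \<le> M * s"
        using M(2)[OF x] s by (simp add: norm_mult mult_right_mono)
      moreover have "norm (1 + x * complex_of_real s) \<ge> 1 - norm (x * complex_of_real s)"
        using norm_triangle_ineq2[of 1 "- (x * complex_of_real s)"] by simp
      ultimately show ?thesis using True by (simp add: s_def mult.commute)
    next
      case False
      have "complex_of_real (- 1 / s) \<in> q_euler_poles q"
        unfolding q_euler_poles_eq s_def by blast
      from e(2)[OF x this] have "e \<le> norm (x + 1 / complex_of_real s)"
        by (simp add: dist_norm)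
      then have "s * e \<le> s * norm (x + 1 / complex_of_real s)" using s by simp
      also have "\<dots> = norm (complex_of_real s * (x + 1 / complex_of_real s))"
        using s by (simp add: norm_mult)
      also have "complex_of_real s * (x + 1 / complex_of_real s) = 1 + x * complex_of_real s"
        using s by (simp add: field_simps)
      finally have "s * e \<le> norm (1 + x * complex_of_real s)" .
      moreover have "e / (2 * M) \<le> s * e"
        using False M e by (simp add: field_simps)
      ultimately show ?thesis by (simp add: s_def)
    qed
  qed
qed

lemma q_stieltjes_term_bound:
  assumes "norm (x / (1 + x * complex_of_real (q_node q k))) \<le> B"
  shows "norm (complex_of_real (q_weight q k) * (x / (1 + x * complex_of_real (q_node q k))))
           \<le> q_weight q k * B"
proof -
  have "norm (complex_of_real (q_weight q k)) = q_weight q k"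
    using q_weight_pos[of k] by simp
  then show ?thesis
    using assms q_weight_pos[of k] unfolding norm_mult by (simp add: mult_left_mono)
qed

lemma uniform_limit_q_stieltjes:
  assumes K: "compact K" "K \<subseteq> - q_euler_poles q"
  shows "uniform_limit K
    (\<lambda>n x. \<Sum>k<n. complex_of_real (q_weight q k) * (x / (1 + x * complex_of_real (q_node q k))))
    (q_stieltjes q) sequentially"
proof -
  obtain d where d: "d > 0" "\<And>x k. x \<in> K \<Longrightarrow> norm (1 + x * complex_of_real (q_node q k)) \<ge> d"
    using q_stieltjes_denominator[OF K] by blast
  obtain M where M: "M > 0" "\<And>x. x \<in> K \<Longrightarrow> norm x \<le> M"
    using compact_imp_bounded[OF K(1)] bounded_pos by metis
  show ?thesis
    unfolding q_stieltjes_def[abs_def]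
  proof (rule Weierstrass_m_test)
    fix k x assume x: "x \<in> K"
    have "norm (x / (1 + x * complex_of_real (q_node q k))) \<le> M / d"
      unfolding norm_divide using d(1) d(2)[OF x, of k] M(2)[OF x] M(1) by (intro frac_le) auto
    then show "norm (complex_of_real (q_weight q k) * (x / (1 + x * complex_of_real (q_node q k))))
                 \<le> q_weight q k * (M / d)"
      by (rule q_stieltjes_term_bound)
  next
    show "summable (\<lambda>k. q_weight q k * (M / d))"
      by (intro summable_mult2 sums_summable[OF q_weight_sums_1])
  qed
qed

lemma q_stieltjes_sums:
  assumes "x \<notin> q_euler_poles q"
  shows "(\<lambda>k. complex_of_real (q_weight q k) * (x / (1 + x * complex_of_real (q_node q k))))
           sums q_stieltjes q x"
  using uniform_limit_q_stieltjes[of "{x}"] assms by (simp add: sums_def)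

text \<open>Since the weights have total mass 1, a bound on the kernel valid for every k passes to
  the transform with the same constant. This is how bounds independent of q arise.\<close>

lemma q_stieltjes_bound:
  assumes "x \<notin> q_euler_poles q"
    and "\<And>k. norm (x / (1 + x * complex_of_real (q_node q k))) \<le> B"
  shows "norm (q_stieltjes q x) \<le> B"
proof (rule norm_sums_le[OF q_stieltjes_sums[OF assms(1)] _ q_stieltjes_term_bound[OF assms(2)]])
  show "(\<lambda>k. q_weight q k * B) sums B"
    using sums_mult2[OF q_weight_sums_1, of B] by simp
qed

lemma q_stieltjes_denominator_nonzero:
  assumes "x \<notin> q_euler_poles q"
  shows "1 + x * complex_of_real (q_node q k) \<noteq> 0"
proof -
  obtain d where "d > 0" "\<And>y k. y \<in> {x} \<Longrightarrow> norm (1 + y * complex_of_real (q_node q k)) \<ge> d"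
    by (rule q_stieltjes_denominator[of "{x}"]) (use assms in auto)
  from this(1) this(2)[of x k] show ?thesis by auto
qed

lemma holomorphic_q_stieltjes: "q_stieltjes q holomorphic_on - q_euler_poles q"
proof (rule holomorphic_uniform_sequence)
  show "open (- q_euler_poles q)" using closed_q_euler_poles by blast
  show "(\<lambda>x. \<Sum>k<n. complex_of_real (q_weight q k) * (x / (1 + x * complex_of_real (q_node q k))))
          holomorphic_on - q_euler_poles q" for n
    using q_stieltjes_denominator_nonzero by (intro holomorphic_intros) auto
  fix x assume "x \<in> - q_euler_poles q"
  then obtain d where "d > 0" "cball x d \<subseteq> - q_euler_poles q"
    using closed_q_euler_poles by (meson open_Compl open_contains_cball)
  then show "\<exists>d>0. cball x d \<subseteq> - q_euler_poles q \<and> uniform_limit (cball x d)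
      (\<lambda>n x. \<Sum>k<n. complex_of_real (q_weight q k) * (x / (1 + x * complex_of_real (q_node q k))))
      (q_stieltjes q) sequentially"
    using uniform_limit_q_stieltjes[OF compact_cball] by (intro exI conjI)
qed

section \<open>Agreement with the q-Euler series and uniqueness of continuation\<close>

lemma ball_subset_q_euler_domain: "ball 0 (1 - q) \<subseteq> - q_euler_poles q"
proof -
  have "norm (complex_of_real (- 1 / q_node q k)) \<ge> 1 - q" for k
    using q q_node_le[of k] q_node_pos[of k] unfolding norm_of_real by (simp add: field_simps)
  then have "norm p \<ge> 1 - q" if "p \<in> q_euler_poles q" for p
    using that unfolding q_euler_poles_eq by (elim imageE) simp
  then show ?thesis by force
qed

lemma slit_subset_q_euler_domain: "- \<real>\<^sub>\<le>\<^sub>0 \<subseteq> - q_euler_poles q"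
proof -
  have "- 1 / q_node q k \<le> 0" for k using q_node_pos[of k] by simp
  then show ?thesis unfolding q_euler_poles_eq by (auto simp del: of_real_divide)
qed

text \<open>Expand each \<open>x / (1 + x s)\<close> as a finite geometric sum; the remainder is uniformly small in \<open>s\<close>.\<close>

lemma q_euler_series_eq:
  assumes x: "x \<in> ball 0 (1 - q)"
  shows "q_euler_series q x = q_stieltjes q x"
proof -
  define s where "s = (\<lambda>k. complex_of_real (q_node q k))"
  define w where "w = (\<lambda>k. complex_of_real (q_weight q k))"
  \<comment> \<open>The largest node is 1/(1 - q), so r < 1 dominates |x s_k| for all k at
    once.\<close>
  define r where "r = norm x / (1 - q)"
  have r: "0 \<le> r" "r < 1" using x q by (auto simp: r_def)
  have xs: "norm (x * s k) \<le> r" for k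
  proof -
    have "norm (x * s k) = norm x * q_node q k"
      using q_node_pos[of k] by (simp add: s_def norm_mult)
    also have "\<dots> \<le> norm x * (1 / (1 - q))" by (intro mult_left_mono q_node_le) auto
    finally show ?thesis by (simp add: r_def)
  qed
  have nx: "x \<notin> q_euler_poles q" using x ball_subset_q_euler_domain by blast
  have denom: "1 + x * s k \<noteq> 0" for k
    using q_stieltjes_denominator_nonzero[OF nx] by (simp add: s_def)
  have ns: "norm (1 + x * s k) \<ge> 1 - r" for k
    using norm_triangle_ineq2[of 1 "- (x * s k)"] xs[of k] by simp
  have le: "norm ((\<Sum>n<N. (-1) ^ n * complex_of_real (q_factorial q n) * x ^ (n + 1)) - q_stieltjes q x)
          \<le> norm x / (1 - r) * r ^ N" for N
  proof -
    have moment: "(\<lambda>k. w k * s k ^ n) sums complex_of_real (q_factorial q n)" for n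
      using sums_of_real[OF q_weight_node_moment[of n]] by (simp add: w_def s_def)
    have "(\<lambda>k. \<Sum>n<N. (-1) ^ n * (w k * s k ^ n) * x ^ (n + 1))
            sums (\<Sum>n<N. (-1) ^ n * complex_of_real (q_factorial q n) * x ^ (n + 1))"
      by (intro sums_sum sums_mult sums_mult2 moment)
    from sums_diff[OF this q_stieltjes_sums[OF nx]]
    have S: "(\<lambda>k. (\<Sum>n<N. (-1) ^ n * (w k * s k ^ n) * x ^ (n + 1)) - w k * (x / (1 + x * s k)))
            sums ((\<Sum>n<N. (-1) ^ n * complex_of_real (q_factorial q n) * x ^ (n + 1)) - q_stieltjes q x)"
      by (simp add: w_def s_def)
    \<comment> \<open>The moments turn the partial sum into an average over k of geometric sums with
      ratio -x s_k. Only the geometric remainder survives the subtraction.\<close>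
    have T: "(\<Sum>n<N. (-1) ^ n * (w k * s k ^ n) * x ^ (n + 1)) - w k * (x / (1 + x * s k))
            = - (w k * (x / (1 + x * s k)) * (- (x * s k)) ^ N)" for k
    proof -
      have "(\<Sum>n<N. (-1) ^ n * (w k * s k ^ n) * x ^ (n + 1)) = w k * x * (\<Sum>n<N. (- (x * s k)) ^ n)"
        unfolding sum_distrib_left
        by (intro sum.cong refl) (simp add: power_mult_distrib power_minus[of "x * s k"])
      also have "(\<Sum>n<N. (- (x * s k)) ^ n) = (1 - (- (x * s k)) ^ N) / (1 + x * s k)"
        using denom[of k] one_diff_power_eq[of "- (x * s k)" N] by (simp add: field_simps)
      finally show ?thesis by (simp add: diff_divide_distrib right_diff_distrib)
    qed
    have bnd: "norm (- (w k * (x / (1 + x * s k)) * (- (x * s k)) ^ N))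
            \<le> q_weight q k * (norm x / (1 - r) * r ^ N)" for k
    proof -
      have "norm (x / (1 + x * s k)) \<le> norm x / (1 - r)"
        unfolding norm_divide using ns[of k] r by (intro frac_le) auto
      moreover have "norm (- (x * s k)) ^ N \<le> r ^ N"
        using xs[of k] by (intro power_mono) auto
      ultimately have "norm (x / (1 + x * s k)) * norm (- (x * s k)) ^ N \<le> norm x / (1 - r) * r ^ N"
        using r by (intro mult_mono) auto
      then show ?thesis
        using q_weight_pos[of k]
        by (simp only: norm_mult norm_power w_def mult.assoc norm_minus_cancel norm_of_real abs_of_pos)
           (rule mult_left_mono, auto)
    qed
    have B: "(\<lambda>k. q_weight q k * (norm x / (1 - r) * r ^ N)) sums (norm x / (1 - r) * r ^ N)"
      using sums_mult2[OF q_weight_sums_1, of "norm x / (1 - r) * r ^ N"] by (simp only: mult_1)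
    show ?thesis
      using norm_sums_le[OF S B] bnd unfolding T by blast
  qed
  have lim: "(\<lambda>N. norm x / (1 - r) * r ^ N) \<longlonglongrightarrow> 0"
    using r by (intro tendsto_mult_right_zero LIMSEQ_power_zero) auto
  have "(\<lambda>N. (\<Sum>n<N. (-1) ^ n * complex_of_real (q_factorial q n) * x ^ (n + 1))
          - q_stieltjes q x) \<longlonglongrightarrow> 0"
    by (rule Lim_null_comparison[OF always_eventually[OF allI[OF le]] lim])
  then have "(\<lambda>n. (-1) ^ n * complex_of_real (q_factorial q n) * x ^ (n + 1)) sums q_stieltjes q x"
    unfolding sums_def using LIM_zero_iff by blast
  then show ?thesis unfolding q_euler_series_def by (rule sums_unique[symmetric])
qed

end

text \<open>The function \<open>g\<close> plays two parts: its existence makes the chosen function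
  satisfy its specification, and the identity theorem on the connected set \<open>D\<close> then
  forces that choice to equal \<open>g\<close>.\<close>

lemma analytic_continuation_to_eq:
  assumes "open U" "U \<noteq> {}" "U \<subseteq> D" "open D" "connected D"
    and "g holomorphic_on D" "\<And>x. x \<in> U \<Longrightarrow> g x = f x" "x \<in> D"
  shows "analytic_continuation_to f U D x = g x"
proof -
  have "\<exists>g. g holomorphic_on D \<and> (\<forall>x\<in>U. g x = f x)" using assms by blast
  from someI_ex[OF this] have *: "analytic_continuation_to f U D holomorphic_on D"
      "\<forall>x\<in>U. analytic_continuation_to f U D x = f x"
    unfolding analytic_continuation_to_def by blast+
  show ?thesis
    by (rule analytic_continuation_open[of U D]) (use assms * in auto)
qed

lemma q_euler_eq_q_stieltjes:
  assumes "0 < q" "q < 1" "x \<notin> q_euler_poles q"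
  shows "q_euler q x = q_stieltjes q x"
  unfolding q_euler_def
proof (rule analytic_continuation_to_eq[where U = "ball 0 (1 - q)"])
  show "open (- q_euler_poles q)"
    using closed_q_euler_poles[OF assms(1,2)] by (rule open_Compl)
  show "x \<in> - q_euler_poles q" using assms(3) by simp
  show "ball 0 (1 - q) \<noteq> {}" using assms(2) by simp
qed (rule open_ball ball_subset_q_euler_domain connected_q_euler_domain holomorphic_q_stieltjes
      q_euler_series_eq[symmetric] assms | assumption)+

section \<open>The q-difference equation and bounds uniform in q\<close>

lemma q_stieltjes_q_difference:
  assumes q: "0 < q" "q < 1"
    and x: "x \<notin> q_euler_poles q" "complex_of_real q * x \<notin> q_euler_poles q"
  shows "(x + complex_of_real (1 - q)) * q_stieltjes q x
           = x * q_stieltjes q (complex_of_real q * x) + complex_of_real (1 - q) * x"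
proof -
  define w where "w = (\<lambda>k. complex_of_real (q_weight q k))"
  define s where "s = (\<lambda>k. complex_of_real (q_node q k))"
  define p where "p = complex_of_real q"
  \<comment> \<open>Since (1 - q) s_k = q^k, the k-th term times x + 1 - q splits into (1 - q) x w_k
    and \<open>f k\<close>. The recurrence of the weights and s_(k+1) = q s_k turn the shifted
    \<open>f\<close> into the series at q x; \<open>f 0\<close> vanishes.\<close>
  define f where "f = (\<lambda>k. (1 - p ^ k) * w k * (x * x / (1 + x * s k)))"
  have "(\<lambda>k. f (Suc k)) sums (x * q_stieltjes q (p * x))"
  proof -
    have "f (Suc k) = x * (w k * (p * x / (1 + p * x * s k)))" for k
    proof -
      have "(1 - p ^ Suc k) * w (Suc k) = p * w k"
        using arg_cong[OF q_weight_Suc[OF q, of k], of complex_of_real] by (simp add: p_def w_def)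
      then show ?thesis
        by (simp only: f_def) (simp add: s_def p_def q_node_Suc[OF q] mult_ac)
    qed
    then show ?thesis
      using sums_mult[OF q_stieltjes_sums[OF q x(2)], of x] by (simp add: p_def w_def s_def)
  qed
  then have f: "f sums (x * q_stieltjes q (p * x))"
    by (rule sums_Suc_imp[rotated]) (simp add: f_def)
  have w: "(\<lambda>k. w k * ((1 - p) * x)) sums ((1 - p) * x)"
    using sums_mult2[OF sums_of_real[OF q_weight_sums_1[OF q]], of "(1 - p) * x"]
    by (simp add: w_def)
  have eq: "w k * ((1 - p) * x) + f k = (x + (1 - p)) * (w k * (x / (1 + x * s k)))" for k
  proof -
    have nz: "1 + x * s k \<noteq> 0"
      using q_stieltjes_denominator_nonzero[OF q x(1)] by (simp add: s_def)
    have "(1 - p) * s k = p ^ k" using q by (simp add: s_def p_def q_node_def)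
    moreover have "(1 - p) * x * (1 + x * s k) = (1 - p) * x + x * x * ((1 - p) * s k)"
      by (simp add: algebra_simps)
    ultimately have "(1 - p) * x * (1 + x * s k) = (1 - p) * x + x * x * p ^ k" by (simp only:)
    then have "(1 - p) * x * (1 + x * s k) + (1 - p ^ k) * (x * x) = (x + (1 - p)) * x"
      by (simp add: algebra_simps)
    then have "(1 - p) * x + (1 - p ^ k) * (x * x / (1 + x * s k)) = (x + (1 - p)) * (x / (1 + x * s k))"
      using nz by (simp add: add_divide_eq_iff)
    then have "w k * ((1 - p) * x + (1 - p ^ k) * (x * x / (1 + x * s k)))
                 = w k * ((x + (1 - p)) * (x / (1 + x * s k)))" by (simp only:)
    then show ?thesis by (simp only: f_def distrib_left mult_ac)
  qed
  have "(\<lambda>k. (x + (1 - p)) * (w k * (x / (1 + x * s k))))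
          sums ((1 - p) * x + x * q_stieltjes q (p * x))"
    using sums_add[OF w f] by (simp only: eq)
  moreover have "(\<lambda>k. (x + (1 - p)) * (w k * (x / (1 + x * s k)))) sums ((x + (1 - p)) * q_stieltjes q x)"
    unfolding w_def s_def by (intro sums_mult q_stieltjes_sums q x)
  ultimately have "(x + (1 - p)) * q_stieltjes q x = x * q_stieltjes q (p * x) + (1 - p) * x"
    by (simp only: add.commute sums_unique2)
  then show ?thesis by (simp add: p_def)
qed

text \<open>The kernel equals 1/(1/x + s). Inversion sends K to a compact set off the closed
  negative axis, which contains -s for every node and every q, so the distance between the two sets
  bounds all kernels simultaneously.\<close>

lemma q_stieltjes_bounded_on_compact:
  assumes K: "compact K" "K \<subseteq> - \<real>\<^sub>\<le>\<^sub>0"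
  obtains B where "\<And>q x. 0 < q \<Longrightarrow> q < 1 \<Longrightarrow> x \<in> K \<Longrightarrow> norm (q_stieltjes q x) \<le> B"
proof -
  have K0: "x \<noteq> 0" if "x \<in> K" for x using K that by auto
  have "compact (inverse ` K)"
    using K0 by (intro compact_continuous_image K continuous_intros) auto
  moreover have "inverse ` K \<inter> \<real>\<^sub>\<le>\<^sub>0 = {}" using K(2) by auto
  ultimately obtain d where d: "d > 0"
      "\<And>x y. x \<in> K \<Longrightarrow> y \<in> \<real>\<^sub>\<le>\<^sub>0 \<Longrightarrow> d \<le> dist (inverse x) y"
    using separate_compact_closed[of "inverse ` K" "\<real>\<^sub>\<le>\<^sub>0"] by auto
  show ?thesis
  proof (rule that)
    fix q :: real and x assume q: "0 < q" "q < 1" and x: "x \<in> K"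
    show "norm (q_stieltjes q x) \<le> 1 / d"
    proof (rule q_stieltjes_bound[OF q])
      show "x \<notin> q_euler_poles q"
        using slit_subset_q_euler_domain[OF q] K(2) x by blast
      fix k
      have "complex_of_real (- q_node q k) \<in> \<real>\<^sub>\<le>\<^sub>0"
        unfolding nonpos_Reals_of_real_iff using q_node_pos[OF q, of k] by simp
      from d(2)[OF x this] have "d \<le> norm (inverse x + complex_of_real (q_node q k))"
        by (simp add: dist_norm)
      moreover have "x / (1 + x * complex_of_real (q_node q k))
                       = 1 / (inverse x + complex_of_real (q_node q k))"
      proof -
        have "1 + x * complex_of_real (q_node q k) = x * (inverse x + complex_of_real (q_node q k))"
          using K0[OF x] by (simp add: distrib_left)
        then show ?thesis using K0[OF x] by simp
      qed
      ultimately show "norm (x / (1 + x * complex_of_real (q_node q k))) \<le> 1 / d"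
        using d(1) by (simp add: norm_divide frac_le)
    qed
  qed
qed

text \<open>Together with the same bound for the Euler integral, this makes both functions tend to 0
  at the origin, uniformly in q. That is where the iteration along the positive axis ends.\<close>

lemma q_stieltjes_pos_bound:
  assumes q: "0 < q" "q < 1" and "0 < (y::real)"
  shows "norm (q_stieltjes q (complex_of_real y)) \<le> y"
proof (rule q_stieltjes_bound[OF q])
  show "complex_of_real y \<notin> q_euler_poles q"
    using slit_subset_q_euler_domain[OF q] assms(3) nonpos_Reals_of_real_iff[of y] by fastforce
  fix k
  have "norm (complex_of_real y / (1 + complex_of_real y * complex_of_real (q_node q k)))
          = norm (complex_of_real (y / (1 + y * q_node q k)))" by simp
  also have "\<dots> = y / (1 + y * q_node q k)"
    using assms(3) q_node_pos[OF q, of k] unfolding norm_of_real by simp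
  also have "\<dots> \<le> y"
    using assms(3) q_node_pos[OF q, of k] by (simp add: divide_le_eq add_pos_pos)
  finally show "norm (complex_of_real y / (1 + complex_of_real y * complex_of_real (q_node q k))) \<le> y" .
qed

section \<open>The Euler integral and its continuation to the slit plane\<close>

lemma exp_decay_lborel:
  assumes "a > (0::real)"
  shows "set_integrable lborel {0..} (\<lambda>t. exp (- a * t))"
    and "(LBINT t:{0..}. exp (- a * t)) = 1 / a"
proof -
  have I: "((\<lambda>t. exp (- a * t)) has_integral 1 / a) {0..}"
    using has_integral_exp_minus_to_infinity[OF assms, of 0] by simp
  then have "(\<lambda>t. exp (- a * t)) absolutely_integrable_on {0..}"
    by (intro nonnegative_absolutely_integrable_1) (auto intro: has_integral_integrable)
  then show *: "set_integrable lborel {0..} (\<lambda>t. exp (- a * t))"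
    unfolding set_integrable_def by (subst (asm) integrable_completion) auto
  show "(LBINT t:{0..}. exp (- a * t)) = 1 / a"
    using set_borel_integral_eq_integral(2)[OF *] I by (simp add: integral_unique)
qed

lemma norm_laplace_integrand_le:
  assumes "t \<ge> (0::real)"
  shows "norm (exp (- complex_of_real t * z) / (complex_of_real t + 1)) \<le> exp (- Re z * t)"
proof -
  have "norm (complex_of_real t + 1) = t + 1"
    using norm_of_real[of "t + 1", where 'a = complex] assms by simp
  then show ?thesis
    using assms by (simp add: norm_divide divide_le_eq mult_le_cancel_left1 mult.commute)
qed

lemma set_integrable_laplace:
  assumes "Re z > 0"
  shows "set_integrable lborel {0..} (\<lambda>t. exp (- complex_of_real t * z) / (complex_of_real t + 1))"
proof (rule set_integrable_bound[OF exp_decay_lborel(1)[OF assms]])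
  show "set_borel_measurable lborel {0..}
          (\<lambda>t. exp (- complex_of_real t * z) / (complex_of_real t + 1))"
    unfolding set_borel_measurable_def by measurable
qed (use norm_laplace_integrand_le[of _ z] in auto)

lemma euler_integral_pos_bound:
  assumes "0 < (y::real)"
  shows "norm (euler_integral (complex_of_real y)) \<le> y"
proof -
  define z where "z = complex_of_real (1 / y)"
  have z: "Re z > 0" "Re z = 1 / y" using assms by (simp_all add: z_def)
  have "euler_integral (complex_of_real y)
          = (LBINT t:{0..}. exp (- complex_of_real t * z) / (complex_of_real t + 1))"
    by (simp add: euler_integral_def z_def)
  also have "norm \<dots> \<le> (LBINT t:{0..}. norm (exp (- complex_of_real t * z) / (complex_of_real t + 1)))"
    by (rule set_integral_norm_bound[OF set_integrable_laplace[OF z(1)]])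
  also have "\<dots> \<le> (LBINT t:{0..}. exp (- Re z * t))"
    by (intro set_integral_mono set_integrable_norm set_integrable_laplace z(1)
          exp_decay_lborel(1) norm_laplace_integrand_le) auto
  also have "\<dots> = y" using exp_decay_lborel(2)[OF z(1)] z(2) by simp
  finally show ?thesis .
qed

lemma open_slit_plane: "open (- \<real>\<^sub>\<le>\<^sub>0 :: complex set)"
  by (intro open_Compl closed_nonpos_Reals_complex)

text \<open>Starlikeness yields both a primitive of exp(-w)/w on the whole slit plane and its
  connectedness.\<close>

lemma starlike_slit_plane: "starlike (- \<real>\<^sub>\<le>\<^sub>0 :: complex set)"
proof -
  have "(\<real>\<^sub>\<le>\<^sub>0 :: complex set) = complex_of_real ` {..0}"
    by (auto elim: nonpos_Reals_cases)
  then show ?thesis using starlike_slotted_complex_plane_left[of 0] by simp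
qed

text \<open>Substituting \<open>w = z (1 + t)\<close> makes the integral a difference of values of a primitive \<open>P\<close> of
  \<open>exp (- w) / w\<close>. The value of \<open>P\<close> at infinity does not depend on the direction in the right
  half-plane, and \<open>P\<close> lives on the whole slit plane; this is the analytic continuation.\<close>

lemma euler_integral_continuation:
  obtains E where
    "\<And>x. x \<in> - \<real>\<^sub>\<le>\<^sub>0 \<Longrightarrow> (E has_field_derivative (x - E x) / x\<^sup>2) (at x)"
    "\<And>x. Re x > 0 \<Longrightarrow> E x = euler_integral x"
proof -
  have hol: "(\<lambda>w. exp (- w) / w) holomorphic_on (- \<real>\<^sub>\<le>\<^sub>0 :: complex set)"
    by (intro holomorphic_intros) auto
  have "\<exists>P. \<forall>w \<in> - (\<real>\<^sub>\<le>\<^sub>0 :: complex set). (P has_field_derivative exp (- w) / w) (at w)"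
    by (rule holomorphic_starlike_primitive[OF holomorphic_on_imp_continuous_on[OF hol]
          starlike_slit_plane open_slit_plane finite.emptyI])
       (use holomorphic_on_imp_differentiable_at[OF hol open_slit_plane] in simp)
  then obtain P where P: "\<And>w::complex. w \<notin> \<real>\<^sub>\<le>\<^sub>0 \<Longrightarrow> (P has_field_derivative exp (- w) / w) (at w)"
    by (metis ComplI)
  have pos: "w \<notin> \<real>\<^sub>\<le>\<^sub>0" if "Re w > 0" for w
    using that by (auto simp: complex_nonpos_Reals_iff)
  define L where "L = (\<lambda>z. LBINT t:{0..}. exp (- complex_of_real t * z) / (complex_of_real t + 1))"

  have lim: "((\<lambda>b. P (z * complex_of_real (1 + b))) \<longlongrightarrow> exp (- z) * L z + P z) at_top"
    if z: "Re z > 0" for z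
  proof -
    \<comment> \<open>As a function of t, exp(z) P(z (1 + t)) is a primitive of the integrand; b
      then goes to infinity.\<close>
    have "(LBINT t:{0..b}. exp (- complex_of_real t * z) / (complex_of_real t + 1))
            = exp z * P (z * complex_of_real (1 + b)) - exp z * P (z * complex_of_real (1 + 0))"
      if b: "b \<ge> 0" for b
      unfolding set_lebesgue_integral_def
    proof (rule integral_FTC_atLeastAtMost[OF b])
      have nz: "complex_of_real t + 1 \<noteq> 0" if "t \<ge> 0" for t
        using that by (auto simp: complex_eq_iff)
      show "continuous_on {0..b} (\<lambda>t. exp (- complex_of_real t * z) / (complex_of_real t + 1))"
        using nz by (intro continuous_intros) auto
      fix t assume t: "0 \<le> t" "t \<le> b"
      have "Re (z * complex_of_real (1 + t)) > 0" using z t by simp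
      note P = P[OF pos[OF this]]
      have "((\<lambda>u. exp z * P (z * (1 + u))) has_field_derivative
               exp z * (exp (- (z * (1 + complex_of_real t))) / (z * (1 + complex_of_real t)) * z))
            (at (complex_of_real t))"
        using P by (auto intro!: derivative_eq_intros DERIV_chain2[of P])
      also have "exp z * (exp (- (z * (1 + complex_of_real t))) / (z * (1 + complex_of_real t)) * z)
                   = exp (- complex_of_real t * z) / (complex_of_real t + 1)"
      proof -
        have "exp z * exp (- (z * (1 + complex_of_real t))) = exp (- complex_of_real t * z)"
          by (simp flip: exp_add) (simp add: algebra_simps)
        moreover have "z \<noteq> 0" using z by auto
        then have "exp z * (exp (- (z * (1 + complex_of_real t))) / (z * (1 + complex_of_real t)) * z)
                     = exp z * exp (- (z * (1 + complex_of_real t))) / (complex_of_real t + 1)"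
          by (simp add: add.commute)
        ultimately show ?thesis by (simp only:)
      qed
      finally have "((\<lambda>u. exp z * P (z * (1 + u))) has_field_derivative
               exp (- complex_of_real t * z) / (complex_of_real t + 1)) (at (complex_of_real t))" .
      from has_vector_derivative_real_field[OF this]
      show "((\<lambda>b. exp z * P (z * complex_of_real (1 + b))) has_vector_derivative
               exp (- complex_of_real t * z) / (complex_of_real t + 1)) (at t within {0..b})"
        by simp
    qed
    then have eq: "\<forall>\<^sub>F b in at_top.
        exp (- z) * (LBINT t:{0..b}. exp (- complex_of_real t * z) / (complex_of_real t + 1)) + P z
          = P (z * complex_of_real (1 + b))"
      by (intro eventually_at_top_linorderI[of 0])
         (simp add: right_diff_distrib mult.assoc[symmetric] flip: exp_add)
    have "((\<lambda>b. LBINT t:{0..b}. exp (- complex_of_real t * z) / (complex_of_real t + 1)) \<longlongrightarrow> L z) at_top"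
      unfolding L_def by (intro tendsto_set_lebesgue_integral_at_top set_integrable_laplace z) auto
    then have "((\<lambda>b. exp (- z) * (LBINT t:{0..b}. exp (- complex_of_real t * z) / (complex_of_real t + 1))
                 + P z) \<longlongrightarrow> exp (- z) * L z + P z) at_top"
      by (intro tendsto_intros)
    then show ?thesis by (rule Lim_transform_eventually) (rule eq)
  qed

  \<comment> \<open>Both z (1 + b) and 1 + b lie in the half-plane Re w >= (1 + b) m with m = min(1,
    Re z). There P' is exponentially small in b, while the distance of the two points grows only
    linearly.\<close>
  have diff: "((\<lambda>b. P (z * complex_of_real (1 + b)) - P (1 * complex_of_real (1 + b))) \<longlongrightarrow> 0) at_top"
    if z: "Re z > 0" for z
  proof -
    define m where "m = min 1 (Re z)"
    have m: "m > 0" "m \<le> 1" "m \<le> Re z" using z by (auto simp: m_def)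
    have "norm (P (z * complex_of_real (1 + b)) - P (1 * complex_of_real (1 + b)))
            \<le> norm (z - 1) / m * exp (- ((1 + b) * m))" if b: "b \<ge> 0" for b
    proof -
      have Rm: "(1 + b) * m > 0" using b m by simp
      have "norm (P (z * complex_of_real (1 + b)) - P (1 * complex_of_real (1 + b)))
            \<le> exp (- ((1 + b) * m)) / ((1 + b) * m)
                * norm (z * complex_of_real (1 + b) - 1 * complex_of_real (1 + b))"
      proof (rule field_differentiable_bound[of "{w. Re w \<ge> (1 + b) * m}" P "\<lambda>w. exp (- w) / w"])
        show "convex {w. Re w \<ge> (1 + b) * m}" by (rule convex_halfspace_Re_ge)
        fix w assume w: "w \<in> {w. Re w \<ge> (1 + b) * m}"
        then have "Re w > 0" using Rm by simp
        then show "(P has_field_derivative exp (- w) / w) (at w within {w. Re w \<ge> (1 + b) * m})"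
          by (rule has_field_derivative_at_within[OF P[OF pos]])
        have "norm w \<ge> (1 + b) * m" using w complex_Re_le_cmod[of w] by simp
        then show "norm (exp (- w) / w) \<le> exp (- ((1 + b) * m)) / ((1 + b) * m)"
          using w Rm unfolding norm_divide norm_exp_eq_Re by (intro frac_le) auto
      next
        show "z * complex_of_real (1 + b) \<in> {w. Re w \<ge> (1 + b) * m}"
          using m b mult_right_mono[OF m(3), of "1 + b"] by (simp add: mult.commute)
        show "1 * complex_of_real (1 + b) \<in> {w. Re w \<ge> (1 + b) * m}"
          using m b mult_left_mono[OF m(2), of "1 + b"] by simp
      qed
      also have "norm (z * complex_of_real (1 + b) - 1 * complex_of_real (1 + b)) = norm (z - 1) * (1 + b)"
        unfolding left_diff_distrib[symmetric] norm_mult norm_of_real using b by simp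
      also have "exp (- ((1 + b) * m)) / ((1 + b) * m) * (norm (z - 1) * (1 + b))
                   = norm (z - 1) / m * exp (- ((1 + b) * m))"
      proof -
        have "e / (R * m) * (n * R) = n / m * e" if "R \<noteq> 0" for e n R :: real
          using that m(1) by (simp add: field_simps)
        from this[of "1 + b"] show ?thesis using b by simp
      qed
      finally show ?thesis .
    qed
    then have "\<forall>\<^sub>F b in at_top. norm (P (z * complex_of_real (1 + b)) - P (1 * complex_of_real (1 + b)))
            \<le> norm (z - 1) / m * exp (- ((1 + b) * m))"
      by (intro eventually_at_top_linorderI[of 0])
    moreover have "((\<lambda>b. norm (z - 1) / m * exp (- ((1 + b) * m))) \<longlongrightarrow> 0) at_top"
    proof (intro tendsto_mult_right_zero filterlim_compose[OF exp_at_bot])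
      show "LIM b at_top. - ((1 + b) * m) :> at_bot"
        unfolding filterlim_uminus_at_top[symmetric]
        using m by (intro filterlim_at_top_mult_tendsto_pos[OF tendsto_const] 
            filterlim_tendsto_add_at_top[OF tendsto_const] filterlim_ident) auto
    qed
    ultimately show ?thesis by (rule Lim_null_comparison)
  qed

  \<comment> \<open>By \<open>lim\<close> at 1 this is the limit of P along the positive axis; by
    \<open>diff\<close> it is the limit along every ray in the right half-plane.\<close>
  define c where "c = exp (- 1) * L 1 + P 1"
  have L: "L z = exp z * (c - P z)" if z: "Re z > 0" for z
  proof -
    have "exp (- z) * L z + P z - c = 0"
      using tendsto_unique[OF _ tendsto_diff[OF lim[OF z] lim[of 1]] diff[OF z]] by (simp add: c_def)
    then have "exp (- z) * L z = c - P z" by (simp add: algebra_simps)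
    then have "exp z * (exp (- z) * L z) = exp z * (c - P z)" by (simp only:)
    then show ?thesis by (simp add: mult.assoc[symmetric] flip: exp_add)
  qed

  \<comment> \<open>This is the formula for L(1/x). It makes sense on the whole slit plane, which
    inversion maps to itself.\<close>
  define E where "E = (\<lambda>x. exp (1 / x) * (c - P (1 / x)))"
  show ?thesis
  proof (rule that[of E])
    fix x :: complex assume x: "x \<in> - \<real>\<^sub>\<le>\<^sub>0"
    then have x0: "x \<noteq> 0" by auto
    have "1 / x \<notin> \<real>\<^sub>\<le>\<^sub>0" using x by (simp add: divide_inverse)
    note P = P[OF this]
    have "(E has_field_derivative
             exp (1 / x) * (- 1 / x\<^sup>2) * (c - P (1 / x))
               + exp (1 / x) * - (exp (- (1 / x)) / (1 / x) * (- 1 / x\<^sup>2))) (at x)"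
      unfolding E_def using x0 P
      by (auto intro!: derivative_eq_intros DERIV_chain2[of P] simp: power2_eq_square)
    also have "exp (1 / x) * (- 1 / x\<^sup>2) * (c - P (1 / x))
                 + exp (1 / x) * - (exp (- (1 / x)) / (1 / x) * (- 1 / x\<^sup>2)) = (x - E x) / x\<^sup>2"
    proof -
      have "exp (1 / x) * exp (- (1 / x)) = 1" by (simp flip: exp_add)
      then have "exp (1 / x) * - (exp (- (1 / x)) / (1 / x) * (- 1 / x\<^sup>2)) = x / x\<^sup>2"
        by simp
      then show ?thesis by (simp add: E_def diff_divide_distrib)
    qed
    finally show "(E has_field_derivative (x - E x) / x\<^sup>2) (at x)" .
  next
    fix x :: complex assume "Re x > 0"
    then have "Re (1 / x) > 0"
      by (simp add: Re_divide divide_pos_pos add_pos_nonneg)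
    from L[OF this] show "E x = euler_integral x"
      by (simp add: E_def L_def euler_integral_def divide_inverse)
  qed
qed

lemma connected_slit_plane: "connected (- \<real>\<^sub>\<le>\<^sub>0 :: complex set)"
  by (rule starlike_imp_connected[OF starlike_slit_plane])

text \<open>Uniqueness of continuation transfers both properties from the explicit E. The
  differential equation drives the comparison with the q-difference equation, and the integral
  controls the size near 0.\<close>

lemma euler_fun_properties:
  shows has_field_derivative_euler_fun:
      "x \<notin> \<real>\<^sub>\<le>\<^sub>0 \<Longrightarrow> (euler_fun has_field_derivative (x - euler_fun x) / x\<^sup>2) (at x)"
    and euler_fun_eq_integral: "Re x > 0 \<Longrightarrow> euler_fun x = euler_integral x"
proof -
  obtain E where E: "\<And>x. x \<in> - \<real>\<^sub>\<le>\<^sub>0 \<Longrightarrow> (E has_field_derivative (x - E x) / x\<^sup>2) (at x)"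
    and int: "\<And>x. Re x > 0 \<Longrightarrow> E x = euler_integral x"
    using euler_integral_continuation by blast
  have hol: "E holomorphic_on - \<real>\<^sub>\<le>\<^sub>0"
    using E by (auto simp: holomorphic_on_open[OF open_slit_plane])
  have eq: "euler_fun x = E x" if "x \<in> - \<real>\<^sub>\<le>\<^sub>0" for x
    unfolding euler_fun_def
  proof (rule analytic_continuation_to_eq[OF _ _ _ open_slit_plane connected_slit_plane hol int that])
    show "open {x. Re x > 0}" by (rule open_halfspace_Re_gt)
    show "{x. Re x > 0} \<noteq> {}" by (auto intro: exI[of _ 1])
    show "{x. Re x > 0} \<subseteq> - \<real>\<^sub>\<le>\<^sub>0" by (auto simp: complex_nonpos_Reals_iff)
  qed simp
  show "(euler_fun has_field_derivative (x - euler_fun x) / x\<^sup>2) (at x)" if "x \<notin> \<real>\<^sub>\<le>\<^sub>0"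
  proof -
    have x: "x \<in> - \<real>\<^sub>\<le>\<^sub>0" using that by simp
    show ?thesis
      unfolding eq[OF x]
      by (rule has_field_derivative_transform_within_open[OF E[OF x] open_slit_plane x eq[symmetric]])
  qed
  show "euler_fun x = euler_integral x" if "Re x > 0"
    using that eq[of x] int[of x] by (auto simp: complex_nonpos_Reals_iff)
qed

section \<open>Convergence on the positive axis\<close>

lemma euler_fun_pos_bound:
  assumes "0 < (y::real)"
  shows "norm (euler_fun (complex_of_real y)) \<le> y"
  using euler_integral_pos_bound[OF assms] euler_fun_eq_integral[of "complex_of_real y"] assms by simp

text \<open>The defect of \<open>euler_fun\<close> in the q-difference equation of \<open>q_stieltjes\<close>. By the differential
  equation \<open>y\<^sup>2 E' = y - E\<close> it is controlled by the modulus of continuity of \<open>y - E\<close>,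
  which extends continuously by \<open>0\<close> to \<open>y = 0\<close>.\<close>

lemma euler_fun_q_difference_defect:
  fixes X e :: real
  assumes "0 < X" "0 < e"
  shows "\<forall>\<^sub>F q in at_left 1. \<forall>y. 0 < y \<longrightarrow> y \<le> X \<longrightarrow>
           norm (complex_of_real y * (euler_fun (complex_of_real y) - euler_fun (complex_of_real (q * y)))
             - complex_of_real (1 - q) * (complex_of_real y - euler_fun (complex_of_real y))) \<le> (1 - q) * e"
proof -
  \<comment> \<open>The value 0 at the origin is the continuous one, by the bound 2y below. Uniform
    continuity on the compact interval then gives a \<open>d\<close> that serves all y up to
    X.\<close>
  define g where "g = (\<lambda>y. if y = 0 then 0 else complex_of_real y - euler_fun (complex_of_real y))"
  have g_bound: "norm (g y) \<le> 2 * y" if "0 \<le> y" for y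
  proof (cases "y = 0")
    case False
    then show ?thesis
      using norm_triangle_ineq4[of "complex_of_real y" "euler_fun (complex_of_real y)"]
        euler_fun_pos_bound[of y] that by (simp add: g_def)
  qed (simp add: g_def)
  have "isCont g y" if "0 < y" for y
  proof -
    have "complex_of_real y \<notin> \<real>\<^sub>\<le>\<^sub>0" using that by simp
    then have E: "isCont euler_fun (complex_of_real y)"
      by (rule DERIV_isCont[OF has_field_derivative_euler_fun])
    have id: "isCont complex_of_real y" by (intro continuous_intros)
    have "isCont (\<lambda>y. complex_of_real y - euler_fun (complex_of_real y)) y"
      by (rule isCont_diff[OF id isCont_o2[OF id E]])
    moreover have "\<forall>\<^sub>F z in nhds y. g z = complex_of_real z - euler_fun (complex_of_real z)"
      by (rule eventually_mono[OF eventually_nhds_in_open[of "{0<..}" y]])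
         (use that in \<open>auto simp: g_def\<close>)
    ultimately show ?thesis by (simp add: isCont_cong)
  qed
  moreover have "(g \<longlongrightarrow> g 0) (at 0 within {0..X})"
  proof -
    have "\<forall>\<^sub>F y in at 0 within {0..X}. norm (g y) \<le> 2 * y"
      using g_bound by (auto simp: eventually_at_filter)
    moreover have "((\<lambda>y. 2 * y) \<longlongrightarrow> 0) (at 0 within {0..X})"
      by (auto intro!: tendsto_eq_intros)
    ultimately have "(g \<longlongrightarrow> 0) (at 0 within {0..X})" by (rule Lim_null_comparison)
    then show ?thesis by (simp add: g_def)
  qed
  ultimately have "continuous_on {0..X} g"
    unfolding continuous_on_eq_continuous_within
    by (metis atLeastAtMost_iff continuous_at_imp_continuous_within continuous_within less_eq_real_def)
  then have "uniformly_continuous_on {0..X} g"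
    by (intro compact_uniformly_continuous) auto
  then obtain d where d: "d > 0"
      "\<And>x y. x \<in> {0..X} \<Longrightarrow> y \<in> {0..X} \<Longrightarrow> dist x y < d \<Longrightarrow> dist (g x) (g y) < e / 2"
    using assms(2) unfolding uniformly_continuous_on_def by (metis half_gt_zero)

  \<comment> \<open>For t between q y and y, the first condition controls (y/t)^2 - 1 and the second
    keeps t within \<open>d\<close> of y.\<close>
  have "((\<lambda>q. ((1 / q)\<^sup>2 - 1) * (2 * X)) \<longlongrightarrow> ((1 / 1)\<^sup>2 - 1) * (2 * X)) (at_left 1)"
    by (intro tendsto_intros) auto
  then have ev1: "\<forall>\<^sub>F q in at_left 1. ((1 / q)\<^sup>2 - 1) * (2 * X) < e / 2"
    using assms(2) by (intro order_tendstoD(2)) auto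
  have "((\<lambda>q. (1 - q) * X) \<longlongrightarrow> (1 - 1) * X) (at_left 1)"
    by (intro tendsto_intros)
  then have ev2: "\<forall>\<^sub>F q in at_left 1. (1 - q) * X < d"
    using d(1) by (intro order_tendstoD(2)) auto
  have ev3: "\<forall>\<^sub>F q in at_left (1::real). 0 < q \<and> q < 1"
    using eventually_at_left_real[of 0 1] by simp
  show ?thesis
    using ev1 ev2 ev3
  proof eventually_elim
    case (elim q)
    then have q: "0 < q" "q < 1" by auto
    show ?case
    proof (intro allI impI)
      fix y :: real assume y: "0 < y" "y \<le> X"
      define F' where "F' = (\<lambda>z. (z - euler_fun z) / z\<^sup>2)"
      define S where "S = closed_segment (complex_of_real (q * y)) (complex_of_real y)"
      have qy: "0 < q * y" "q * y \<le> y" using q y by (auto simp: mult_le_cancel_right1)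
      have S: "\<exists>t. z = complex_of_real t \<and> q * y \<le> t \<and> t \<le> y" if "z \<in> S" for z
        using that qy unfolding S_def closed_segment_of_real by (auto simp: closed_segment_eq_real_ivl)
      \<comment> \<open>Subtracting the linear part with the slope at y leaves the derivative F' z -
        F' y. Multiplied by y, the increment of \<open>h\<close> from q y to y is exactly the
        defect.\<close>
      define h where "h = (\<lambda>z. euler_fun z - z * F' (complex_of_real y))"
      have "norm (h (complex_of_real y) - h (complex_of_real (q * y)))
              \<le> e / y\<^sup>2 * norm (complex_of_real y - complex_of_real (q * y))"
      proof (rule field_differentiable_bound[where S = S and f' = "\<lambda>z. F' z - F' (complex_of_real y)"])
        show "convex S" "complex_of_real y \<in> S" "complex_of_real (q * y) \<in> S"
          by (simp_all add: S_def)
        fix z assume "z \<in> S"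
        then obtain t where t: "z = complex_of_real t" "q * y \<le> t" "t \<le> y" using S by blast
        then have t0: "0 < t" using qy by simp
        have "z \<notin> \<real>\<^sub>\<le>\<^sub>0" using t t0 by simp
        then have "((\<lambda>z. euler_fun z - z * c) has_field_derivative F' z - c) (at z within S)" for c
          unfolding F'_def
          by (auto intro!: derivative_eq_intros has_field_derivative_at_within[OF has_field_derivative_euler_fun])
        then show "(h has_field_derivative F' z - F' (complex_of_real y)) (at z within S)"
          unfolding h_def .
        have F': "F' (complex_of_real u) = g u / complex_of_real (u\<^sup>2)" if "u > 0" for u
          using that by (simp add: F'_def g_def)
        \<comment> \<open>Scaling by y^2 replaces the singular 1/t^2 by the harmless ratio (y/t)^2.
          What remains is a change of scale times g(t), plus an increment of g.\<close>
        have "complex_of_real (y\<^sup>2) * (F' z - F' (complex_of_real y)) = complex_of_real ((y / t)\<^sup>2) * g t - g y"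
          using t0 y by (simp add: t(1) F' right_diff_distrib power_divide)
        also have "\<dots> = complex_of_real ((y / t)\<^sup>2 - 1) * g t + (g t - g y)"
          by (simp add: algebra_simps)
        also have "norm \<dots> \<le> norm (complex_of_real ((y / t)\<^sup>2 - 1) * g t) + norm (g t - g y)"
          by (rule norm_triangle_ineq)
        also have "norm (complex_of_real ((y / t)\<^sup>2 - 1) * g t) \<le> ((1 / q)\<^sup>2 - 1) * (2 * X)"
        proof -
          have "1 \<le> y / t" "y / t \<le> 1 / q"
            using t t0 q by (auto simp: field_simps)
          then have "1 \<le> (y / t)\<^sup>2" "(y / t)\<^sup>2 \<le> (1 / q)\<^sup>2"
            by (auto intro: one_le_power power_mono)
          then have "\<bar>(y / t)\<^sup>2 - 1\<bar> \<le> (1 / q)\<^sup>2 - 1" by simp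
          moreover have "norm (g t) \<le> 2 * X" using g_bound[of t] t0 t y by simp
          ultimately show ?thesis
            unfolding norm_mult norm_of_real by (intro mult_mono) auto
        qed
        also have "norm (g t - g y) \<le> e / 2"
        proof -
          have "(1 - q) * y \<le> (1 - q) * X" using q y by (intro mult_left_mono) auto
          then have "dist t y < d"
            using t elim(2) by (simp add: dist_real_def algebra_simps)
          then show ?thesis
            using d(2)[of t y] t0 t y by (simp add: dist_norm)
        qed
        finally have "norm (complex_of_real (y\<^sup>2) * (F' z - F' (complex_of_real y))) \<le> e"
          using elim(1) by simp
        then show "norm (F' z - F' (complex_of_real y)) \<le> e / y\<^sup>2"
          using y unfolding norm_mult norm_of_real by (simp add: pos_le_divide_eq mult.commute)
      qed
      also have "norm (complex_of_real y - complex_of_real (q * y)) = (1 - q) * y"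
        unfolding of_real_diff[symmetric] norm_of_real using qy by (simp add: algebra_simps)
      finally have "y * norm (h (complex_of_real y) - h (complex_of_real (q * y)))
                      \<le> y * (e / y\<^sup>2 * ((1 - q) * y))"
        using y by (intro mult_left_mono) auto
      also have "\<dots> = (1 - q) * e" using y by (simp add: power2_eq_square)
      also have "y * norm (h (complex_of_real y) - h (complex_of_real (q * y)))
                   = norm (complex_of_real y * (h (complex_of_real y) - h (complex_of_real (q * y))))"
        using y by (simp add: norm_mult)
      also have "complex_of_real y * (h (complex_of_real y) - h (complex_of_real (q * y)))
          = complex_of_real y * (euler_fun (complex_of_real y) - euler_fun (complex_of_real (q * y)))
            - complex_of_real (1 - q) * ((complex_of_real y)\<^sup>2 * F' (complex_of_real y))"
        by (simp add: h_def power2_eq_square algebra_simps)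
      also have "(complex_of_real y)\<^sup>2 * F' (complex_of_real y) = complex_of_real y - euler_fun (complex_of_real y)"
        using y by (simp add: F'_def)
      finally show "norm (complex_of_real y * (euler_fun (complex_of_real y) - euler_fun (complex_of_real (q * y)))
             - complex_of_real (1 - q) * (complex_of_real y - euler_fun (complex_of_real y))) \<le> (1 - q) * e" .
    qed
  qed
qed

text \<open>On the positive axis the q-difference equation exhibits the error at \<open>y\<close> as a weighted
  average of the error at \<open>q y\<close> and of the defect, so it can be iterated down to \<open>0\<close>.\<close>

lemma q_stieltjes_tendsto_pos:
  assumes X: "0 < (X::real)"
  shows "((\<lambda>q. q_stieltjes q (complex_of_real X)) \<longlongrightarrow> euler_fun (complex_of_real X)) (at_left 1)"
proof (rule tendstoI)
  fix e :: real assume e: "0 < e"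
  then have "0 < e / 2" by simp
  note euler_fun_q_difference_defect[OF X this]
  moreover have "\<forall>\<^sub>F q in at_left (1::real). 0 < q \<and> q < 1"
    using eventually_at_left_real[of 0 1] by simp
  ultimately show "\<forall>\<^sub>F q in at_left 1. dist (q_stieltjes q (complex_of_real X)) (euler_fun (complex_of_real X)) < e"
  proof eventually_elim
    case (elim q)
    then have q: "0 < q" "q < 1" by auto
    define D where "D = (\<lambda>y. q_stieltjes q (complex_of_real y) - euler_fun (complex_of_real y))"
    have step: "norm (D y) \<le> max (norm (D (q * y))) (e / 2)" if y: "0 < y" "y \<le> X" for y
    proof -
      define m where "m = max (norm (D (q * y))) (e / 2)"
      have "complex_of_real u \<notin> q_euler_poles q" if "u > 0" for u
        using slit_subset_q_euler_domain[OF q] that nonpos_Reals_of_real_iff[of u, where 'a = complex] by fastforce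
      from q_stieltjes_q_difference[OF q this[OF y(1)]] this[of "q * y"] q y
      have eq: "(complex_of_real y + complex_of_real (1 - q)) * q_stieltjes q (complex_of_real y)
              = complex_of_real y * q_stieltjes q (complex_of_real (q * y)) + complex_of_real (1 - q) * complex_of_real y"
        by simp
      define r where "r = complex_of_real y * (euler_fun (complex_of_real y) - euler_fun (complex_of_real (q * y)))
             - complex_of_real (1 - q) * (complex_of_real y - euler_fun (complex_of_real y))"
      have "(y + (1 - q)) * norm (D y) = norm ((complex_of_real y + complex_of_real (1 - q)) * D y)"
        using y q unfolding norm_mult of_real_add[symmetric] norm_of_real by simp
      \<comment> \<open>The error obeys the q-difference equation with the defect r as source. As
        |r| <= (1 - q) e/2, dividing by y + (1 - q) gives an average of at most the larger of |D(q
        y)| and e/2.\<close>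
      also have "(complex_of_real y + complex_of_real (1 - q)) * D y = complex_of_real y * D (q * y) - r"
        unfolding D_def r_def right_diff_distrib eq by (simp add: algebra_simps)
      also have "norm \<dots> \<le> norm (complex_of_real y * D (q * y)) + norm r"
        by (rule norm_triangle_ineq4)
      also have "\<dots> \<le> y * m + (1 - q) * m"
      proof (rule add_mono)
        show "norm (complex_of_real y * D (q * y)) \<le> y * m"
          using y by (simp add: norm_mult m_def)
        have "norm r \<le> (1 - q) * (e / 2)" using elim y unfolding r_def by blast
        also have "\<dots> \<le> (1 - q) * m" using q by (intro mult_left_mono) (auto simp: m_def)
        finally show "norm r \<le> (1 - q) * m" .
      qed
      also have "\<dots> = (y + (1 - q)) * m" by (simp add: algebra_simps)
      finally show ?thesis using y q by (simp add: m_def)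
    qed
    have iter: "norm (D X) \<le> max (norm (D (q ^ n * X))) (e / 2)" for n
    proof (induction n)
      case (Suc n)
      have "norm (D (q ^ n * X)) \<le> max (norm (D (q * (q ^ n * X)))) (e / 2)"
        using q X by (intro step) (auto simp: mult_le_cancel_right1 power_le_one)
      with Suc show ?case by (simp add: mult.assoc)
    qed simp
    \<comment> \<open>Here n may depend on q, since iterating a maximum accumulates no
      error.\<close>
    have "(\<lambda>n. 2 * (q ^ n * X)) \<longlonglongrightarrow> 0"
      using q by (intro tendsto_mult_right_zero tendsto_mult_left_zero LIMSEQ_power_zero) auto
    then have "\<forall>\<^sub>F n in sequentially. 2 * (q ^ n * X) < e / 2"
      using e by (intro order_tendstoD(2)[where y = 0]) auto
    then obtain n where n: "2 * (q ^ n * X) < e / 2"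
      by (auto simp: eventually_sequentially)
    have "0 < q ^ n * X" using q X by simp
    then have "norm (D (q ^ n * X)) \<le> 2 * (q ^ n * X)"
      unfolding D_def
      using norm_triangle_ineq4[of "q_stieltjes q (complex_of_real (q ^ n * X))" "euler_fun (complex_of_real (q ^ n * X))"]
        q_stieltjes_pos_bound[OF q, of "q ^ n * X"] euler_fun_pos_bound[of "q ^ n * X"] by linarith
    with n iter[of n] have "norm (D X) \<le> e / 2" by simp
    then show ?case using e by (simp add: D_def dist_norm)
  qed
qed

section \<open>Normal families and locally uniform convergence\<close>

lemma uniform_limit_q_stieltjes_euler_fun:
  assumes K: "compact K" "K \<subseteq> - \<real>\<^sub>\<le>\<^sub>0"
  shows "uniform_limit K q_stieltjes euler_fun (at_left 1)"
proof (rule uniform_limitI, rule ccontr)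
  fix e :: real assume e: "0 < e"
  define Good where "Good = (\<lambda>q. \<forall>x\<in>K. dist (q_stieltjes q x) (euler_fun x) < e)"
  assume "\<not> (\<forall>\<^sub>F q in at_left 1. \<forall>x\<in>K. dist (q_stieltjes q x) (euler_fun x) < e)"
  then have not: "\<not> (\<forall>\<^sub>F q in at_left 1. Good q)" by (simp add: Good_def)
  \<comment> \<open>Montel's theorem concerns sequences, so failure of the limit is turned into a
    sequence of bad parameters. The lower bound keeps them positive and drives them to 1.\<close>
  have "\<exists>q. max 0 (1 - 1 / real (Suc n)) < q \<and> q < 1 \<and> \<not> Good q" for n
    using not eventually_at_left[of "max 0 (1 - 1 / real (Suc n))" 1 Good] by auto
  then obtain f where f: "\<And>n. max 0 (1 - 1 / real (Suc n)) < f n" "\<And>n. f n < 1" "\<And>n. \<not> Good (f n)"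
    by metis
  then have f0: "0 < f n" for n by (metis max_less_iff_conj)
  have "f \<longlonglongrightarrow> 1"
  proof (rule tendsto_sandwich)
    show "\<forall>\<^sub>F n in sequentially. 1 - 1 / real (Suc n) \<le> f n"
      using f(1) by (auto intro!: always_eventually simp: less_imp_le)
    show "\<forall>\<^sub>F n in sequentially. f n \<le> 1" using f(2) by (auto intro!: always_eventually less_imp_le)
    show "(\<lambda>n. 1 - 1 / real (Suc n)) \<longlonglongrightarrow> 1"
      using tendsto_diff[OF tendsto_const LIMSEQ_inverse_real_of_nat, of "1::real"]
      by (simp add: inverse_eq_divide)
  qed auto
  then have f_lim: "filterlim f (at_left 1) sequentially"
    unfolding filterlim_at using f(2) by (auto intro!: always_eventually simp: less_imp_neq)
  define H where "H = q_stieltjes ` {0<..<1}"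
  obtain h r where h: "h holomorphic_on - \<real>\<^sub>\<le>\<^sub>0" and r: "strict_mono (r :: nat \<Rightarrow> nat)"
    and ptw: "\<And>x. x \<in> - \<real>\<^sub>\<le>\<^sub>0 \<Longrightarrow> (\<lambda>n. q_stieltjes (f (r n)) x) \<longlonglongrightarrow> h x"
    and unif: "\<And>K. compact K \<Longrightarrow> K \<subseteq> - \<real>\<^sub>\<le>\<^sub>0 \<Longrightarrow> uniform_limit K ((\<lambda>n. q_stieltjes (f n)) \<circ> r) h sequentially"
  proof (rule Montel[OF open_slit_plane, of H "\<lambda>n. q_stieltjes (f n)"])
    show "k holomorphic_on - \<real>\<^sub>\<le>\<^sub>0" if "k \<in> H" for k
      using that holomorphic_on_subset[OF holomorphic_q_stieltjes slit_subset_q_euler_domain]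
      unfolding H_def by auto
    show "\<exists>B. \<forall>h\<in>H. \<forall>z\<in>K. norm (h z) \<le> B" if "compact K" "K \<subseteq> - \<real>\<^sub>\<le>\<^sub>0" for K
      using q_stieltjes_bounded_on_compact[OF that] unfolding H_def by (metis greaterThanLessThan_iff imageE)
    show "range (\<lambda>n. q_stieltjes (f n)) \<subseteq> H"
      using f0 f(2) by (auto simp: H_def)
  qed blast
  have fr: "filterlim (\<lambda>n. f (r n)) (at_left 1) sequentially"
    by (rule filterlim_compose[OF f_lim filterlim_subseq[OF r]])
  have pos: "h (complex_of_real y) = euler_fun (complex_of_real y)" if "0 < y" for y
  proof (rule LIMSEQ_unique)
    show "(\<lambda>n. q_stieltjes (f (r n)) (complex_of_real y)) \<longlonglongrightarrow> h (complex_of_real y)"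
      using that by (intro ptw) auto
    show "(\<lambda>n. q_stieltjes (f (r n)) (complex_of_real y)) \<longlonglongrightarrow> euler_fun (complex_of_real y)"
      by (rule filterlim_compose[OF q_stieltjes_tendsto_pos[OF that] fr])
  qed
  \<comment> \<open>The positive reals have a limit point inside the slit plane, for instance 1, so
    agreement there already forces agreement everywhere.\<close>
  have eq: "h x - euler_fun x = 0" if x: "x \<in> - \<real>\<^sub>\<le>\<^sub>0" for x
  proof (rule analytic_continuation[where f = "\<lambda>x. h x - euler_fun x" and w = x
        and S = "- \<real>\<^sub>\<le>\<^sub>0" and U = "complex_of_real ` {0<..}" and \<xi> = 1])
    have "euler_fun holomorphic_on - \<real>\<^sub>\<le>\<^sub>0"
      using has_field_derivative_euler_fun by (auto simp: holomorphic_on_open[OF open_slit_plane])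
    then show "(\<lambda>x. h x - euler_fun x) holomorphic_on - \<real>\<^sub>\<le>\<^sub>0"
      using h by (intro holomorphic_intros)
    show "1 islimpt complex_of_real ` {0<..}"
      unfolding islimpt_approachable
    proof (intro allI impI)
      fix \<epsilon> :: real assume "0 < \<epsilon>"
      then have "dist (complex_of_real (1 + \<epsilon> / 2)) (complex_of_real 1) < \<epsilon>"
        unfolding dist_of_real by (simp add: dist_real_def)
      with \<open>0 < \<epsilon>\<close> show "\<exists>x'\<in>complex_of_real ` {0<..}. x' \<noteq> 1 \<and> dist x' 1 < \<epsilon>"
        by (intro bexI[of _ "complex_of_real (1 + \<epsilon> / 2)"])
           (auto simp del: of_real_add)
    qed
  qed (use x pos open_slit_plane connected_slit_plane in auto)
  have "\<forall>\<^sub>F n in sequentially. \<forall>x\<in>K. dist (q_stieltjes (f (r n)) x) (h x) < e"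
    using uniform_limitD[OF unif[OF K] e] by simp
  then obtain n where "\<forall>x\<in>K. dist (q_stieltjes (f (r n)) x) (h x) < e"
    by (auto simp: eventually_sequentially)
  moreover have "h x = euler_fun x" if "x \<in> K" for x using eq[of x] K(2) that by auto
  ultimately have "Good (f (r n))" by (simp add: Good_def)
  then show False using f(3) by blast
qed

theorem theorem1p4:
  shows "(\<forall>x \<in> - \<real>\<^sub>\<le>\<^sub>0. ((\<lambda>q. q_euler q x) \<longlongrightarrow> euler_fun x) (at_left 1)) \<and>
         (\<forall>K. compact K \<and> K \<subseteq> - \<real>\<^sub>\<le>\<^sub>0 \<longrightarrow> uniform_limit K q_euler euler_fun (at_left 1))"
proof -
  have unif: "uniform_limit K q_euler euler_fun (at_left 1)" if K: "compact K" "K \<subseteq> - \<real>\<^sub>\<le>\<^sub>0" for K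
  proof -
    \<comment> \<open>The identification of \<open>q_euler\<close> with \<open>q_stieltjes\<close>
      holds for q in (0,1), hence eventually, which is enough for the limit.\<close>
    have "\<forall>\<^sub>F q in at_left (1::real). 0 < q \<and> q < 1"
      using eventually_at_left_real[of 0 1] by simp
    then have "\<forall>\<^sub>F q in at_left 1. \<forall>x\<in>K. q_euler q x = q_stieltjes q x"
    proof eventually_elim
      case (elim q)
      then show ?case
        using q_euler_eq_q_stieltjes[of q] slit_subset_q_euler_domain[of q] K(2) by blast
    qed
    then show ?thesis
      using uniform_limit_q_stieltjes_euler_fun[OF K] by (subst uniform_limit_cong) auto
  qed
  moreover have "((\<lambda>q. q_euler q x) \<longlongrightarrow> euler_fun x) (at_left 1)" if "x \<in> - \<real>\<^sub>\<le>\<^sub>0" for x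
    using unif[of "{x}"] that by simp
  ultimately show ?thesis by blast
qed

end
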